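(* The Gromov--Hausdorff class $\mathcal{GH}$, equipped with the generalized pseudometric $d_{GH}$, is complete: for every sequence $X_1,X_2,\ldots$ of non-empty metric spaces that is fundamental (Cauchy) with respect to $d_{GH}$, there exists a non-empty metric space $X$ such that $d_{GH}(X_n,X)\to 0$ as $n\to\infty$. In particular, every cloud is complete with respect to the restriction of $d_{GH}$, i.e., every fundamental sequence of spaces of a cloud converges to a space of this cloud.
   Context: All metric spaces are non-empty, with finite distances; no compactness or boundedness is assumed. $\mathcal{GH}$ denotes the proper class of all non-empty metric spaces considered up to isometry. For metric spaces $X,Y$, the Gromov--Hausdorff distance $d_{GH}(X,Y)\in[0,\infty]$ is the infimum of the Hausdorff distances $d_H(X',Y')$ over all metric spaces $Z$ and all subsets $X',Y'\subset Z$ with $X'$ isometric to $X$ and $Y'$ isometric to $Y$, where $d_H(A,B)=\inf\{r>0: A\subset U_r(B),\ B\subset U_r(A)\}$ and $U_r(A)$ is the open $r$-neighborhood of $A$. It is a generalized pseudometric (it may take the value $\infty$, and may vanish on non-isometric spaces). A cloud is an equivalence class of the relation $d_{GH}(X,Y)<\infty$ on $\mathcal{GH}$. A sequence $(X_n)$ is fundamental if for every $\varepsilon>0$ there is $N$ such that $d_{GH}(X_n,X_m)<\varepsilon$ for all $n,m\ge N$. *)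

theory Defs
  imports "HOL-Analysis.Analysis"
begin

text \<open>
  Metric spaces are elements of the library type \<^typ>\<open>'a metric\<close>: a carrier set inside the type
  together with a real-valued distance on it.  The proper class of all metric spaces is represented
  by these types for arbitrary \<^typ>\<open>'a\<close>; spaces are not quotiented by isometry, but all notions
  below are invariant under isometry.
\<close>

definition isometric_spaces :: "'a metric \<Rightarrow> 'b metric \<Rightarrow> bool" where
  "isometric_spaces X Y \<longleftrightarrow>
     (\<exists>f. bij_betw f (mspace X) (mspace Y) \<and>
          (\<forall>x\<in>mspace X. \<forall>y\<in>mspace X. mdist Y (f x) (f y) = mdist X x y))"

definition nbhd :: "'a metric \<Rightarrow> real \<Rightarrow> 'a set \<Rightarrow> 'a set" where
  "nbhd Z r A = (\<Union>a\<in>A. mball_of Z a r)"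

text \<open>The infimum in \<^typ>\<open>ennreal\<close> of the empty set is infinite.\<close>

definition hausdorff_dist :: "'a metric \<Rightarrow> 'a set \<Rightarrow> 'a set \<Rightarrow> ennreal" where
  "hausdorff_dist Z A B =
     Inf {ennreal r | r. 0 < r \<and> A \<subseteq> nbhd Z r B \<and> B \<subseteq> nbhd Z r A}"

text \<open>
  The ambient space ranges over the metric spaces carried by subsets of \<^typ>\<open>'a + 'b\<close>.  This loses
  nothing: only the points of the two isometric copies matter, and there are few enough of them to
  be moved into this type.  The lemma \<open>gh_dist_le\<close> below proves that ambient spaces over any other
  type give the same infimum.
\<close>

definition gh_dist :: "'a metric \<Rightarrow> 'b metric \<Rightarrow> ennreal" where
  "gh_dist X Y =
     Inf {hausdorff_dist Z X' Y' | (Z :: ('a + 'b) metric) X' Y'.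
            X' \<subseteq> mspace Z \<and> Y' \<subseteq> mspace Z \<and>
            isometric_spaces (submetric Z X') X \<and> isometric_spaces (submetric Z Y') Y}"

lemma gh_dist_le:
  fixes Z :: "'c metric" and X :: "'a metric" and Y :: "'b metric"
  assumes X': "X' \<subseteq> mspace Z" and Y': "Y' \<subseteq> mspace Z"
    and isoX: "isometric_spaces (submetric Z X') X"
    and isoY: "isometric_spaces (submetric Z Y') Y"
  shows "gh_dist X Y \<le> hausdorff_dist Z X' Y'"
proof -
  have [simp]: "X' \<inter> mspace Z = X'" "Y' \<inter> mspace Z = Y'"
    using X' Y' by auto
  obtain f where f: "bij_betw f X' (mspace X)"
    and fd: "\<And>x y. x \<in> X' \<Longrightarrow> y \<in> X' \<Longrightarrow> mdist X (f x) (f y) = mdist Z x y"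
    using isoX by (auto simp: isometric_spaces_def)
  obtain g where g: "bij_betw g Y' (mspace Y)"
    and gd: "\<And>x y. x \<in> Y' \<Longrightarrow> y \<in> Y' \<Longrightarrow> mdist Y (g x) (g y) = mdist Z x y"
    using isoY by (auto simp: isometric_spaces_def)
  define \<phi> :: "'c \<Rightarrow> 'a + 'b" where "\<phi> z = (if z \<in> X' then Inl (f z) else Inr (g z))" for z
  define U where "U = X' \<union> Y'"
  have U: "U \<subseteq> mspace Z" "X' \<subseteq> U" "Y' \<subseteq> U"
    using X' Y' by (auto simp: U_def)
  have inj: "inj_on \<phi> U"
    using f g by (auto simp: \<phi>_def U_def inj_on_def bij_betw_def)
  define \<psi> where "\<psi> = inv_into U \<phi>"
  have \<psi>: "\<psi> (\<phi> z) = z" if "z \<in> U" for z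
    using that inj by (simp add: \<psi>_def)
  define W where "W = metric (\<phi> ` U, \<lambda>u v. mdist Z (\<psi> u) (\<psi> v))"
  have ms: "Metric_space (\<phi> ` U) (\<lambda>u v. mdist Z (\<psi> u) (\<psi> v))"
  proof
    show "mdist Z (\<psi> u) (\<psi> v) = mdist Z (\<psi> v) (\<psi> u)" for u v
      by (rule mdist_commute)
    show "(mdist Z (\<psi> u) (\<psi> v) = 0) = (u = v)" if uv: "u \<in> \<phi> ` U" "v \<in> \<phi> ` U" for u v
    proof -
      obtain x y where xy: "x \<in> U" "y \<in> U" "u = \<phi> x" "v = \<phi> y"
        using uv by auto
      have "x \<in> mspace Z" "y \<in> mspace Z"
        using xy U by auto
      then show ?thesis
        using xy inj by (simp add: \<psi> inj_on_eq_iff)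
    qed
    show "mdist Z (\<psi> u) (\<psi> w) \<le> mdist Z (\<psi> u) (\<psi> v) + mdist Z (\<psi> v) (\<psi> w)"
      if "u \<in> \<phi> ` U" "v \<in> \<phi> ` U" "w \<in> \<phi> ` U" for u v w
    proof -
      have "\<psi> u \<in> mspace Z" "\<psi> v \<in> mspace Z" "\<psi> w \<in> mspace Z"
        using that U \<psi> by auto
      then show ?thesis
        by (rule mdist_triangle)
    qed
  qed simp
  have W: "mspace W = \<phi> ` U" "mdist W = (\<lambda>u v. mdist Z (\<psi> u) (\<psi> v))"
    using ms by (simp_all add: W_def Metric_space.mspace_metric Metric_space.mdist_metric)
  have iso: "isometric_spaces (submetric W (\<phi> ` A)) T"
    if A: "A \<subseteq> U" and h: "bij_betw h A (mspace T)"
      and hd: "\<And>x y. x \<in> A \<Longrightarrow> y \<in> A \<Longrightarrow> mdist T (h x) (h y) = mdist Z x y"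
    for A h and T :: "'t metric"
  proof -
    have eq: "\<phi> ` A \<inter> \<phi> ` U = \<phi> ` A"
      using A by auto
    have \<psi>A: "\<psi> (\<phi> z) = z" if "z \<in> A" for z
      using that A \<psi> by auto
    have "bij_betw \<psi> (\<phi> ` A) A"
      by (rule bij_betwI[where g = \<phi>]) (auto simp: \<psi>A)
    then have "bij_betw (h \<circ> \<psi>) (\<phi> ` A) (mspace T)"
      using h by (rule bij_betw_trans)
    then show ?thesis
      unfolding isometric_spaces_def
      by (intro exI[of _ "h \<circ> \<psi>"]) (auto simp: W eq \<psi>A hd)
  qed
  have nb: "\<phi> ` A \<subseteq> nbhd W r (\<phi> ` B)"
    if AB: "A \<subseteq> U" "B \<subseteq> U" and sub: "A \<subseteq> nbhd Z r B" for A B r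
  proof
    fix u assume "u \<in> \<phi> ` A"
    then obtain a where a: "a \<in> A" "u = \<phi> a"
      by auto
    then obtain b where b: "b \<in> B" "mdist Z b a < r"
      using sub by (auto simp: nbhd_def)
    have "a \<in> U" "b \<in> U"
      using a b AB by auto
    then have "u \<in> mball_of W (\<phi> b) r"
      using a b by (simp add: W \<psi>)
    then show "u \<in> nbhd W r (\<phi> ` B)"
      using b by (auto simp: nbhd_def)
  qed
  have "gh_dist X Y \<le> hausdorff_dist W (\<phi> ` X') (\<phi> ` Y')"
    unfolding gh_dist_def
  proof (rule Inf_lower, rule CollectI, intro exI conjI)
    show "\<phi> ` X' \<subseteq> mspace W" "\<phi> ` Y' \<subseteq> mspace W"
      using U by (auto simp: W)
    show "isometric_spaces (submetric W (\<phi> ` X')) X"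
      by (rule iso[OF U(2) f fd])
    show "isometric_spaces (submetric W (\<phi> ` Y')) Y"
      by (rule iso[OF U(3) g gd])
  qed simp
  also have "\<dots> \<le> hausdorff_dist Z X' Y'"
    unfolding hausdorff_dist_def
    using nb[OF U(2,3)] nb[OF U(3,2)] by (intro Inf_superset_mono) blast
  finally show ?thesis .
qed

definition GH_class :: "'a metric set" where
  "GH_class = {X. mspace X \<noteq> {}}"

definition gh_fundamental :: "(nat \<Rightarrow> 'a metric) \<Rightarrow> bool" where
  "gh_fundamental X \<longleftrightarrow>
     (\<forall>\<epsilon>::real. \<epsilon> > 0 \<longrightarrow> (\<exists>N. \<forall>n\<ge>N. \<forall>m\<ge>N. gh_dist (X n) (X m) < ennreal \<epsilon>))"

definition gh_converges :: "(nat \<Rightarrow> 'a metric) \<Rightarrow> 'b metric \<Rightarrow> bool" where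
  "gh_converges X L \<longleftrightarrow> (\<lambda>n. gh_dist (X n) L) \<longlonglongrightarrow> 0"

definition clouds :: "'a metric set set" where
  "clouds = GH_class // {(X, Y). X \<in> GH_class \<and> Y \<in> GH_class \<and> gh_dist X Y < \<infinity>}"

end

theory Submission
  imports Defs
begin

text \<open>
  A space at Gromov--Hausdorff distance less than \<open>r\<close> is related by a correspondence of distortion
  at most \<open>2 * r\<close>, and conversely.  Pass to a subsequence \<open>Y\<close> with
  \<open>gh_dist (Y j) (Y (Suc j)) < (1/2) ^ j\<close> and fix such correspondences.  Through every point of every
  \<open>Y k\<close> there is a thread, a sequence of points with consecutive members related.  The distances
  between two threads converge geometrically, and the limit space consists of one chosen thread per
  point of the spaces \<open>Y k\<close>, modulo limit distance zero.  Restricting to chosen threads keeps the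
  space small enough to live in the type \<open>'a\<close>: if \<open>'a\<close> is infinite, there are no more than
  \<open>nat \<times> 'a\<close> threads, and if \<open>'a\<close> is finite, any finitely many threads at positive distances are
  already separated in some \<open>Y j\<close>.
\<close>

section \<open>Correspondences, distortion and the Gromov--Hausdorff distance\<close>

definition correspondence :: "'a metric \<Rightarrow> 'b metric \<Rightarrow> real \<Rightarrow> ('a \<times> 'b) set \<Rightarrow> bool" where
  "correspondence X Y e R \<longleftrightarrow> Domain R = mspace X \<and> Range R = mspace Y \<and>
     (\<forall>x y x' y'. (x, y) \<in> R \<longrightarrow> (x', y') \<in> R \<longrightarrow> \<bar>mdist X x x' - mdist Y y y'\<bar> \<le> e)"

lemma correspondenceD:
  assumes "correspondence X Y e R" "(x, y) \<in> R"
  shows "x \<in> mspace X" "y \<in> mspace Y"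
    and "(x', y') \<in> R \<Longrightarrow> \<bar>mdist X x x' - mdist Y y y'\<bar> \<le> e"
  using assms unfolding correspondence_def by blast+

lemma correspondence_total:
  assumes "correspondence X Y e R"
  shows "x \<in> mspace X \<Longrightarrow> \<exists>y. (x, y) \<in> R" "y \<in> mspace Y \<Longrightarrow> \<exists>x. (x, y) \<in> R"
  using assms unfolding correspondence_def by blast+

lemma correspondence_relcomp:
  assumes R: "correspondence X Y e R" and S: "correspondence Y Z f S"
  shows "correspondence X Z (e + f) (R O S)"
  unfolding correspondence_def
proof (intro conjI allI impI)
  show "Domain (R O S) = mspace X"
  proof (intro set_eqI iffI)
    fix x assume "x \<in> mspace X"
    then obtain y where y: "(x, y) \<in> R"
      using correspondence_total(1)[OF R] by blast
    then obtain z where "(y, z) \<in> S"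
      using correspondenceD(2)[OF R] correspondence_total(1)[OF S] by blast
    with y show "x \<in> Domain (R O S)"
      by blast
  qed (auto dest: correspondenceD(1)[OF R])
  show "Range (R O S) = mspace Z"
  proof (intro set_eqI iffI)
    fix z assume "z \<in> mspace Z"
    then obtain y where y: "(y, z) \<in> S"
      using correspondence_total(2)[OF S] by blast
    then obtain x where "(x, y) \<in> R"
      using correspondenceD(1)[OF S] correspondence_total(2)[OF R] by blast
    with y show "z \<in> Range (R O S)"
      by blast
  qed (auto dest: correspondenceD(2)[OF S])
next
  fix x z x' z' assume "(x, z) \<in> R O S" "(x', z') \<in> R O S"
  then obtain y y' where "(x, y) \<in> R" "(y, z) \<in> S" "(x', y') \<in> R" "(y', z') \<in> S"
    by blast
  then show "\<bar>mdist X x x' - mdist Z z z'\<bar> \<le> e + f"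
    using correspondenceD(3)[OF R, of x y x' y'] correspondenceD(3)[OF S, of y z y' z'] by linarith
qed

text \<open>Relate two points when their copies in an ambient space are closer than some
  \<open>s < r\<close>. Moving both endpoints across changes a distance by less than
  \<open>2 * s\<close>.\<close>

lemma correspondence_if_gh_dist_less:
  assumes "gh_dist X Y < ennreal r"
  obtains R where "correspondence X Y (2 * r) R"
proof -
  obtain Z :: "('a + 'b) metric" and X' Y' where XY': "X' \<subseteq> mspace Z" "Y' \<subseteq> mspace Z"
    and iso: "isometric_spaces (submetric Z X') X" "isometric_spaces (submetric Z Y') Y"
    and less: "hausdorff_dist Z X' Y' < ennreal r"
    using assms unfolding gh_dist_def Inf_less_iff by blast
  obtain s where s: "s > 0" "ennreal s < ennreal r" "X' \<subseteq> nbhd Z s Y'" "Y' \<subseteq> nbhd Z s X'"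
    using less unfolding hausdorff_dist_def Inf_less_iff by blast
  have sr: "s < r"
    using s by (simp add: ennreal_less_iff)
  have [simp]: "X' \<inter> mspace Z = X'" "Y' \<inter> mspace Z = Y'"
    using XY' by auto
  obtain f where f: "bij_betw f X' (mspace X)"
    and fd: "\<And>x y. x \<in> X' \<Longrightarrow> y \<in> X' \<Longrightarrow> mdist X (f x) (f y) = mdist Z x y"
    using iso(1) by (auto simp: isometric_spaces_def)
  obtain g where g: "bij_betw g Y' (mspace Y)"
    and gd: "\<And>x y. x \<in> Y' \<Longrightarrow> y \<in> Y' \<Longrightarrow> mdist Y (g x) (g y) = mdist Z x y"
    using iso(2) by (auto simp: isometric_spaces_def)
  define R where "R = {(f x, g y) | x y. x \<in> X' \<and> y \<in> Y' \<and> mdist Z x y < s}"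
  have "correspondence X Y (2 * r) R"
    unfolding correspondence_def
  proof (intro conjI allI impI)
    have "\<exists>y\<in>Y'. mdist Z x y < s" if "x \<in> X'" for x
      using subsetD[OF s(3) that] by (auto simp: nbhd_def mdist_commute[of Z x])
    then have "Domain R = f ` X'"
      unfolding R_def by blast
    then show "Domain R = mspace X"
      using f by (simp add: bij_betw_def)
    have "\<exists>x\<in>X'. mdist Z x y < s" if "y \<in> Y'" for y
      using subsetD[OF s(4) that] by (auto simp: nbhd_def)
    then have "Range R = g ` Y'"
      unfolding R_def by blast
    then show "Range R = mspace Y"
      using g by (simp add: bij_betw_def)
  next
    fix u v u' v' assume "(u, v) \<in> R" "(u', v') \<in> R"
    then obtain x y x' y' where *: "u = f x" "v = g y" "u' = f x'" "v' = g y'"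
      "x \<in> X'" "y \<in> Y'" "x' \<in> X'" "y' \<in> Y'" "mdist Z x y < s" "mdist Z x' y' < s"
      unfolding R_def by blast
    have m: "x \<in> mspace Z" "y \<in> mspace Z" "x' \<in> mspace Z" "y' \<in> mspace Z"
      using * XY' by auto
    show "\<bar>mdist X u u' - mdist Y v v'\<bar> \<le> 2 * r"
      using * sr fd gd mdist_triangle[OF m(1,2,3)] mdist_triangle[OF m(2,4,3)]
        mdist_triangle[OF m(2,1,4)] mdist_triangle[OF m(1,3,4)]
        mdist_commute[of Z x y] mdist_commute[of Z x' y']
      by simp
  qed
  then show ?thesis
    by (rule that)
qed

text \<open>The two spaces are glued by giving related points distance \<open>r\<close>.\<close>

lemma gh_dist_le_if_correspondence:
  fixes X :: "'a metric" and Y :: "'b metric"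
  assumes R: "correspondence X Y (2 * r) R" and r: "r > 0" and ne: "mspace X \<noteq> {}"
  shows "gh_dist X Y \<le> ennreal r"
proof -
  \<comment> \<open>Each related pair acts as a bridge of length \<open>r\<close> between the two
    spaces. \<open>w x y\<close> is the infimal length of a route from \<open>x\<close> to
    \<open>y\<close> over a single bridge.\<close>
  define w where "w x y = (INF p\<in>R. mdist X x (fst p) + r + mdist Y (snd p) y)" for x y
  have Rne: "R \<noteq> {}"
    using R ne unfolding correspondence_def by auto
  have w_le: "w x y \<le> mdist X x x' + r + mdist Y y' y" if "(x', y') \<in> R" for x y x' y'
  proof -
    have "bdd_below ((\<lambda>p. mdist X x (fst p) + r + mdist Y (snd p) y) ` R)"
      using r by (intro bdd_belowI[of _ 0]) auto
    from cINF_lower[OF this that] show ?thesis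
      by (simp add: w_def)
  qed
  have le_w: "c \<le> w x y" if "\<And>x' y'. (x', y') \<in> R \<Longrightarrow> c \<le> mdist X x x' + r + mdist Y y' y"
    for c x y
    unfolding w_def using that Rne by (intro cINF_greatest) auto
  have w_pos: "r \<le> w x y" for x y
    by (rule le_w) simp
  have wX: "w x y \<le> mdist X x x' + w x' y" if x: "x \<in> mspace X" "x' \<in> mspace X" for x x' y
  proof -
    have "w x y - mdist X x x' \<le> w x' y"
    proof (rule le_w)
      fix a b assume ab: "(a, b) \<in> R"
      show "w x y - mdist X x x' \<le> mdist X x' a + r + mdist Y b y"
        using w_le[OF ab, of x y] mdist_triangle[OF x correspondenceD(1)[OF R ab]] by simp
    qed
    then show ?thesis by simp
  qed
  have wY: "w x y \<le> w x y' + mdist Y y' y" if y: "y \<in> mspace Y" "y' \<in> mspace Y" for x y y'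
  proof -
    have "w x y - mdist Y y' y \<le> w x y'"
    proof (rule le_w)
      fix a b assume ab: "(a, b) \<in> R"
      show "w x y - mdist Y y' y \<le> mdist X x a + r + mdist Y b y'"
        using w_le[OF ab, of x y] mdist_triangle[OF correspondenceD(2)[OF R ab] y(2,1)] by simp
    qed
    then show ?thesis by simp
  qed
  \<comment> \<open>A detour through the other space is no shortcut: its two bridges cost
    \<open>2 * r\<close>, which pays for the distortion between \<open>mdist X a a'\<close> and
    \<open>mdist Y b b'\<close>.\<close>
  have XX: "mdist X x x' \<le> w x y + w x' y"
    if x: "x \<in> mspace X" "x' \<in> mspace X" and y: "y \<in> mspace Y" for x x' y
  proof -
    \<comment> \<open>With one infimum moved to the left, \<open>le_w\<close> treats the two infima
      one after the other.\<close>
    have "mdist X x x' - w x' y \<le> w x y"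
    proof (rule le_w)
      fix a b assume ab: "(a, b) \<in> R"
      note m = correspondenceD(1,2)[OF R ab]
      have "mdist X x x' - (mdist X x a + r + mdist Y b y) \<le> w x' y"
      proof (rule le_w)
        fix a' b' assume ab': "(a', b') \<in> R"
        note m' = correspondenceD(1,2)[OF R ab']
        show "mdist X x x' - (mdist X x a + r + mdist Y b y) \<le> mdist X x' a' + r + mdist Y b' y"
          using mdist_triangle[OF x(1) m(1) x(2)] mdist_triangle[OF m(1) m'(1) x(2)]
            mdist_triangle[OF m(2) y m'(2)] correspondenceD(3)[OF R ab ab']
            mdist_commute[of X a' x'] mdist_commute[of Y y b']
          by linarith
      qed
      then show "mdist X x x' - w x' y \<le> mdist X x a + r + mdist Y b y" by simp
    qed
    then show ?thesis by simp
  qed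
  have YY: "mdist Y y y' \<le> w x y + w x y'"
    if x: "x \<in> mspace X" and y: "y \<in> mspace Y" "y' \<in> mspace Y" for x y y'
  proof -
    have "mdist Y y y' - w x y' \<le> w x y"
    proof (rule le_w)
      fix a b assume ab: "(a, b) \<in> R"
      note m = correspondenceD(1,2)[OF R ab]
      have "mdist Y y y' - (mdist X x a + r + mdist Y b y) \<le> w x y'"
      proof (rule le_w)
        fix a' b' assume ab': "(a', b') \<in> R"
        note m' = correspondenceD(1,2)[OF R ab']
        show "mdist Y y y' - (mdist X x a + r + mdist Y b y) \<le> mdist X x a' + r + mdist Y b' y'"
          using mdist_triangle[OF y(1) m(2) y(2)] mdist_triangle[OF m(2) m'(2) y(2)]
            mdist_triangle[OF m(1) x m'(1)] correspondenceD(3)[OF R ab ab']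
            mdist_commute[of X a x] mdist_commute[of Y y b]
          by linarith
      qed
      then show "mdist Y y y' - w x y' \<le> mdist X x a + r + mdist Y b y" by simp
    qed
    then show ?thesis by simp
  qed
  define d where "d u v = (case (u, v) of
      (Inl x, Inl x') \<Rightarrow> mdist X x x' | (Inr y, Inr y') \<Rightarrow> mdist Y y y'
    | (Inl x, Inr y) \<Rightarrow> w x y | (Inr y, Inl x) \<Rightarrow> w x y)" for u v :: "'a + 'b"
  have d [simp]: "d (Inl x) (Inl x') = mdist X x x'" "d (Inr y) (Inr y') = mdist Y y y'"
    "d (Inl x) (Inr y) = w x y" "d (Inr y) (Inl x) = w x y" for x x' y y'
    by (simp_all add: d_def)
  \<comment> \<open>Since \<open>w\<close> is at least \<open>r > 0\<close>, points of different
    summands are never identified.\<close>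
  have w0: "0 \<le> w x y" "w x y \<noteq> 0" for x y
    using w_pos[of x y] r by auto
  define U where "U = mspace X <+> mspace Y"
  have ms: "Metric_space U d"
  proof
    show "0 \<le> d u v" for u v
      by (cases u; cases v) (auto simp: w0)
    show "d u v = d v u" for u v
      by (cases u; cases v) (auto simp: mdist_commute)
    show "d u v = 0 \<longleftrightarrow> u = v" if "u \<in> U" "v \<in> U" for u v
      using that by (auto simp: U_def w0)
    show "d u v \<le> d u t + d t v" if "u \<in> U" "t \<in> U" "v \<in> U" for u t v
      using that unfolding U_def
      by (elim PlusE; simp add: mdist_triangle XX YY)
        (use wX wY in \<open>auto simp: mdist_commute add.commute\<close>)
  qed
  define W where "W = metric (U, d)"
  have W: "mspace W = U" "mdist W = d"
    using ms by (simp_all add: W_def Metric_space.mspace_metric Metric_space.mdist_metric)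
  have le: "gh_dist X Y \<le> hausdorff_dist W (Inl ` mspace X) (Inr ` mspace Y)"
  proof (rule gh_dist_le)
    have eq: "Inl ` mspace X \<inter> U = Inl ` mspace X" "Inr ` mspace Y \<inter> U = Inr ` mspace Y"
      by (auto simp: U_def)
    show "Inl ` mspace X \<subseteq> mspace W" "Inr ` mspace Y \<subseteq> mspace W"
      by (auto simp: U_def W)
    show "isometric_spaces (submetric W (Inl ` mspace X)) X"
      unfolding isometric_spaces_def
      by (intro exI[of _ projl] conjI bij_betwI[where g = Inl]) (auto simp: W eq)
    show "isometric_spaces (submetric W (Inr ` mspace Y)) Y"
      unfolding isometric_spaces_def
      by (intro exI[of _ projr] conjI bij_betwI[where g = Inr]) (auto simp: W eq)
  qed
  have w_rel: "w x y \<le> r" if "(x, y) \<in> R" for x y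
  proof -
    have "mdist X x x = 0" "mdist Y y y = 0"
      using correspondenceD(1,2)[OF R that] by simp_all
    then show ?thesis
      using w_le[OF that, of x y] by simp
  qed
  show ?thesis
  \<comment> \<open>Related points are at distance at most \<open>r\<close>, but neighborhoods are
    open; hence the radius \<open>r + e\<close> with arbitrary \<open>e > 0\<close>.\<close>
  proof (rule ennreal_le_epsilon)
    fix e :: real assume e: "e > 0"
    have "Inl ` mspace X \<subseteq> nbhd W (r + e) (Inr ` mspace Y)"
    proof safe
      fix x assume "x \<in> mspace X"
      then obtain y where "(x, y) \<in> R"
        using correspondence_total[OF R] by blast
      then show "Inl x \<in> nbhd W (r + e) (Inr ` mspace Y)"
        using w_rel[of x y] e correspondenceD(1,2)[OF R, of x y]
        by (auto simp: nbhd_def W U_def intro!: bexI[of _ y])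
    qed
    moreover have "Inr ` mspace Y \<subseteq> nbhd W (r + e) (Inl ` mspace X)"
    proof safe
      fix y assume "y \<in> mspace Y"
      then obtain x where "(x, y) \<in> R"
        using correspondence_total[OF R] by blast
      then show "Inr y \<in> nbhd W (r + e) (Inl ` mspace X)"
        using w_rel[of x y] e correspondenceD(1,2)[OF R, of x y]
        by (auto simp: nbhd_def W U_def intro!: bexI[of _ x])
    qed
    ultimately have "hausdorff_dist W (Inl ` mspace X) (Inr ` mspace Y) \<le> ennreal (r + e)"
      unfolding hausdorff_dist_def using r e by (intro Inf_lower CollectI exI[of _ "r + e"]) auto
    then show "gh_dist X Y \<le> ennreal r + ennreal e"
      using le r e by (simp add: ennreal_plus)
  qed
qed

text \<open>Composing correspondences adds the distortions \<open>2 * r\<close> and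
  \<open>2 * s\<close>, and gluing halves the sum. The strict bounds are what yields the
  correspondences.\<close>

lemma gh_dist_triangle_less:
  assumes XY: "gh_dist X Y < ennreal r" and YZ: "gh_dist Y Z < ennreal s" and ne: "mspace X \<noteq> {}"
  shows "gh_dist X Z \<le> ennreal (r + s)"
proof -
  obtain R S where "correspondence X Y (2 * r) R" "correspondence Y Z (2 * s) S"
    using correspondence_if_gh_dist_less XY YZ by metis
  then have "correspondence X Z (2 * (r + s)) (R O S)"
    using correspondence_relcomp[of X Y "2 * r" R Z "2 * s" S] by (simp add: algebra_simps)
  moreover have "0 < r" "0 < s"
    using le_less_trans[OF zero_le XY] le_less_trans[OF zero_le YZ] by simp_all
  ultimately show ?thesis
    using ne by (intro gh_dist_le_if_correspondence) auto
qed

section \<open>Threads and the convergence of their distances\<close>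

text \<open>Totality of the relations to the right extends a thread forwards, by dependent choice;
  totality to the left extends it backwards, by induction on \<open>k\<close> over the shifted
  sequence.\<close>

lemma exists_thread:
  assumes "\<And>j. correspondence (Y j) (Y (Suc j)) (e j) (R j)" and "x \<in> mspace (Y k)"
  shows "\<exists>t. t k = x \<and> (\<forall>j. (t j, t (Suc j)) \<in> R j)"
  using assms
proof (induction k arbitrary: Y e R)
  case 0
  \<comment> \<open>The conjunct for \<open>j = 0\<close> makes the dependent choice start at the
    prescribed point \<open>x\<close>.\<close>
  have "\<exists>t. \<forall>j. (t j \<in> mspace (Y j) \<and> (j = 0 \<longrightarrow> t j = x)) \<and> (t j, t (Suc j)) \<in> R j"
  proof (rule dependent_nat_choice)
    show "\<exists>a. a \<in> mspace (Y 0) \<and> ((0::nat) = 0 \<longrightarrow> a = x)"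
      using 0 by blast
    show "\<exists>b. (b \<in> mspace (Y (Suc n)) \<and> (Suc n = 0 \<longrightarrow> b = x)) \<and> (a, b) \<in> R n"
      if "a \<in> mspace (Y n) \<and> (n = 0 \<longrightarrow> a = x)" for a n
      using that correspondence_total(1)[OF 0(1)] correspondenceD(2)[OF 0(1)] by blast
  qed
  then show ?case by blast
next
  case (Suc k)
  from Suc.IH[of "\<lambda>j. Y (Suc j)" "\<lambda>j. e (Suc j)" "\<lambda>j. R (Suc j)"] Suc.prems
  obtain t where t: "t k = x" "\<And>j. (t j, t (Suc j)) \<in> R (Suc j)"
    by blast
  obtain a where a: "(a, t 0) \<in> R 0"
    using correspondence_total(2)[OF Suc.prems(1)] correspondenceD(1)[OF Suc.prems(1) t(2)] by blast
  \<comment> \<open>\<open>case_nat a t\<close> prepends \<open>a\<close> to the thread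
    \<open>t\<close> of the shifted sequence.\<close>
  have "(case_nat a t j, case_nat a t (Suc j)) \<in> R j" for j
    using a t by (cases j) auto
  then show ?case
    using t(1) by (intro exI[of _ "case_nat a t"]) simp
qed

text \<open>The increments are dominated by a geometric series whose tail from index
  \<open>j\<close> on is \<open>2 * c * (1/2) ^ j\<close>.\<close>

lemma geometric_increments_limit:
  fixes a :: "nat \<Rightarrow> real"
  assumes inc: "\<And>j. \<bar>a (Suc j) - a j\<bar> \<le> c * (1/2) ^ j"
  shows "a \<longlonglongrightarrow> lim a" "\<bar>lim a - a j\<bar> \<le> 2 * c * (1/2) ^ j"
proof -
  \<comment> \<open>The right-hand side is the exact partial geometric sum, so the induction closes;
    its negative term is dropped later because \<open>0 \<le> c\<close>.\<close>
  have bound: "\<bar>a (j + i) - a j\<bar> \<le> 2 * c * (1/2) ^ j - 2 * c * (1/2) ^ (j + i)" for i j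
  proof (induction i)
    case (Suc i)
    then show ?case
      using inc[of "j + i"] by simp
  qed simp
  have "summable (\<lambda>j. a (Suc j) - a j)"
    by (rule summable_comparison_test'[of "\<lambda>j. c * (1/2) ^ j" 0])
      (use inc in \<open>auto intro!: summable_mult summable_geometric\<close>)
  then have "convergent a"
    by (simp add: summable_iff_convergent sum_lessThan_telescope convergent_diff_const_right_iff)
  then show lim: "a \<longlonglongrightarrow> lim a"
    by (simp add: convergent_LIMSEQ_iff)
  have "0 \<le> c"
    using inc[of 0] by simp
  then have "\<bar>a (i + j) - a j\<bar> \<le> 2 * c * (1/2) ^ j" for i
    using bound[of j i] by (simp add: add.commute)
      (smt (verit) zero_le_power mult_nonneg_nonneg divide_nonneg_nonneg)
  then show "\<bar>lim a - a j\<bar> \<le> 2 * c * (1/2) ^ j"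
    by (intro LIMSEQ_le_const2[OF tendsto_rabs[OF tendsto_diff[OF LIMSEQ_ignore_initial_segment[OF lim, of j] tendsto_const]]]) auto
qed

section \<open>Quotients of pseudometrics and their placement in a given type\<close>

text \<open>The quotient of the pseudometric \<open>D\<close> by distance zero, with classes named
  by the values of \<open>p\<close>. The choice of \<open>p\<close> thus decides in which type the
  quotient lives.\<close>

lemma metric_quotient:
  assumes nonneg: "\<And>s t. s \<in> T \<Longrightarrow> t \<in> T \<Longrightarrow> 0 \<le> D s t"
    and sym: "\<And>s t. s \<in> T \<Longrightarrow> t \<in> T \<Longrightarrow> D s t = D t s"
    and tri: "\<And>s t u. s \<in> T \<Longrightarrow> t \<in> T \<Longrightarrow> u \<in> T \<Longrightarrow> D s u \<le> D s t + (D t u :: real)"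
    and zero: "\<And>s t. s \<in> T \<Longrightarrow> t \<in> T \<Longrightarrow> p s = p t \<longleftrightarrow> D s t = 0"
  obtains L where "mspace L = p ` T" "\<And>s t. s \<in> T \<Longrightarrow> t \<in> T \<Longrightarrow> mdist L (p s) (p t) = D s t"
proof -
  define q where "q = inv_into T p"
  have q: "q u \<in> T" "p (q u) = u" if "u \<in> p ` T" for u
    using that by (auto simp: q_def inv_into_into f_inv_into_f)
  \<comment> \<open>The default 0 off the carrier is there because \<open>Metric_space\<close>
    demands nonnegativity and symmetry for all arguments.\<close>
  define d where "d u v = (if u \<in> p ` T \<and> v \<in> p ` T then D (q u) (q v) else 0)" for u v
  have ms: "Metric_space (p ` T) d"
  proof
    show "0 \<le> d u v" for u v
      by (auto simp: d_def nonneg q)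
    show "d u v = d v u" for u v
      by (auto simp: d_def sym q)
    show "d u v = 0 \<longleftrightarrow> u = v" if "u \<in> p ` T" "v \<in> p ` T" for u v
      using that zero[OF q(1) q(1), of u v] by (simp add: d_def q)
    show "d u v \<le> d u t + d t v" if "u \<in> p ` T" "t \<in> p ` T" "v \<in> p ` T" for u t v
      using that by (simp add: d_def q tri)
  qed
  have eq: "d (p s) (p t) = D s t" if st: "s \<in> T" "t \<in> T" for s t
  proof -
    define s' where "s' = q (p s)"
    define t' where "t' = q (p t)"
    have m: "s' \<in> T" "t' \<in> T" "D s s' = 0" "D t t' = 0"
      using st q[of "p s"] q[of "p t"] zero[of s s'] zero[of t t'] by (auto simp: s'_def t'_def)
    \<comment> \<open>Replacing points by others at distance zero leaves \<open>D\<close> unchanged,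
      by the triangle inequality in both directions.\<close>
    have "D s t = D s' t'"
      using tri[of s s' t] tri[of s' t' t] tri[of s' s t'] tri[of s t t'] sym[of s s'] sym[of t t'] st m
      by simp
    then show ?thesis
      using st by (simp add: d_def s'_def t'_def)
  qed
  show ?thesis
    by (rule that[of "metric (p ` T, d)"])
      (use ms eq in \<open>simp_all add: Metric_space.mspace_metric Metric_space.mdist_metric\<close>)
qed

text \<open>If \<open>'a\<close> is finite, the finite subsets of \<open>A\<close> have bounded
  size, so \<open>A\<close> is itself finite and an instance of \<open>fin\<close>. If
  \<open>'a\<close> is infinite, all of \<open>nat \<times> 'a\<close> injects into it.\<close>

lemma inj_on_if_finite_subsets_inj_on:
  fixes A :: "(nat \<times> 'a) set"
  assumes fin: "\<And>F. finite F \<Longrightarrow> F \<subseteq> A \<Longrightarrow> \<exists>f :: nat \<times> 'a \<Rightarrow> 'a. inj_on f F"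
  shows "\<exists>f :: nat \<times> 'a \<Rightarrow> 'a. inj_on f A"
proof (cases "finite (UNIV :: 'a set)")
  case True
  have "card F \<le> card (UNIV :: 'a set)" if "F \<subseteq> A" "finite F" for F
    using fin[OF that(2,1)] True card_inj_on_le[OF _ subset_UNIV] by blast
  then have "finite A"
    using finite_if_finite_subsets_card_bdd[of A "card (UNIV :: 'a set)"] by simp
  then show ?thesis
    using fin by blast
next
  case False
  then have "(card_of (UNIV :: nat set), card_of (UNIV :: 'a set)) \<in> ordLeq"
    by (simp add: infinite_iff_card_of_nat)
  then have "(card_of ((UNIV :: nat set) \<times> (UNIV :: 'a set)), card_of (UNIV :: 'a set)) \<in> ordLeq"
    using card_of_Times_infinite[OF False, of "UNIV :: nat set"] by (simp add: ordIso_iff_ordLeq)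
  then obtain f :: "nat \<times> 'a \<Rightarrow> 'a" where "inj f"
    by (auto simp flip: card_of_ordLeq)
  then show ?thesis
    by (meson inj_on_subset subset_UNIV)
qed

section \<open>The limit of a rapidly converging sequence\<close>

text \<open>Distortions \<open>2 * (1/2) ^ i\<close> summed over \<open>i \<ge> j\<close> give
  \<open>4 * (1/2) ^ j\<close>. This bounds the distortion between \<open>Y j\<close> and the limit,
  and half of it bounds their distance.\<close>

lemma gh_limit_of_fast_sequence:
  fixes Y :: "nat \<Rightarrow> 'a metric"
  assumes ne: "\<And>j. mspace (Y j) \<noteq> {}"
    and fast: "\<And>j. gh_dist (Y j) (Y (Suc j)) < ennreal ((1/2) ^ j)"
  obtains L :: "'a metric" where "mspace L \<noteq> {}" "\<And>j. gh_dist (Y j) L \<le> ennreal (2 * (1/2) ^ j)"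
proof -
  have "\<forall>j. \<exists>R. correspondence (Y j) (Y (Suc j)) (2 * (1/2) ^ j) R"
    using fast correspondence_if_gh_dist_less by metis
  then obtain R where R: "\<And>j. correspondence (Y j) (Y (Suc j)) (2 * (1/2) ^ j) (R j)"
    by metis
  \<comment> \<open>An index \<open>(k, x)\<close> stands for the chosen thread through the point
    \<open>x\<close> of \<open>Y k\<close>.\<close>
  define T where "T = (SIGMA k:UNIV. mspace (Y k))"
  have "\<forall>i\<in>T. \<exists>t. t (fst i) = snd i \<and> (\<forall>j. (t j, t (Suc j)) \<in> R j)"
    using exists_thread[of Y "\<lambda>j. 2 * (1/2) ^ j" R, OF R] by (auto simp: T_def)
  then obtain th where th: "\<And>i. i \<in> T \<Longrightarrow> th i (fst i) = snd i"
      "\<And>i j. i \<in> T \<Longrightarrow> (th i j, th i (Suc j)) \<in> R j"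
    by metis
  have thY: "th i j \<in> mspace (Y j)" if "i \<in> T" for i j
    using correspondenceD(1)[OF R th(2)[OF that]] .
  define D where "D s t = lim (\<lambda>j. mdist (Y j) (th s j) (th t j))" for s t
  have inc: "\<bar>mdist (Y (Suc j)) (th s (Suc j)) (th t (Suc j)) - mdist (Y j) (th s j) (th t j)\<bar>
      \<le> 2 * (1/2) ^ j" if "s \<in> T" "t \<in> T" for s t j
    using correspondenceD(3)[OF R th(2)[OF that(1)] th(2)[OF that(2)], of j] by linarith
  have D: "(\<lambda>j. mdist (Y j) (th s j) (th t j)) \<longlonglongrightarrow> D s t"
    and D_near: "\<bar>D s t - mdist (Y j) (th s j) (th t j)\<bar> \<le> 4 * (1/2) ^ j"
    if "s \<in> T" "t \<in> T" for s t j
    using geometric_increments_limit[of "\<lambda>j. mdist (Y j) (th s j) (th t j)", OF inc[OF that]]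
    by (simp_all add: D_def)
  have nonneg: "0 \<le> D s t" if "s \<in> T" "t \<in> T" for s t
    by (rule LIMSEQ_le_const[OF D[OF that]]) simp
  have sym: "D s t = D t s" for s t
    by (simp add: D_def mdist_commute)
  have tri: "D s u \<le> D s t + D t u" if "s \<in> T" "t \<in> T" "u \<in> T" for s t u
    by (rule LIMSEQ_le[OF D tendsto_add[OF D D]]) (use that mdist_triangle[OF thY thY thY] in blast)+
  have refl: "D s s = 0" if "s \<in> T" for s
  proof -
    have "mdist (Y j) (th s j) (th s j) = 0" for j
      using mdist_zero[OF thY thY] that by blast
    then show ?thesis
      by (simp add: D_def)
  qed
  \<comment> \<open>\<open>rep\<close> selects one index from each class of threads at limit
    distance zero.\<close>
  define rep where "rep t = (SOME s. s \<in> T \<and> D s t = 0)" for t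
  have rep: "rep t \<in> T" "D (rep t) t = 0" if "t \<in> T" for t
    using someI[of "\<lambda>s. s \<in> T \<and> D s t = 0" t] refl[OF that] that by (auto simp: rep_def)
  have rep_eq: "rep s = rep t \<longleftrightarrow> D s t = 0" if st: "s \<in> T" "t \<in> T" for s t
  proof
    assume "rep s = rep t"
    then show "D s t = 0"
      using tri[of s "rep s" t] rep[OF st(1)] rep[OF st(2)] st nonneg[OF st] sym[of s "rep s"] by simp
  next
    assume 0: "D s t = 0"
    have "D u s = D u t" if "u \<in> T" for u
      using tri[of u s t] tri[of u t s] 0 sym[of s t] st that by simp
    \<comment> \<open>Equal predicates have equal Hilbert choices, so equivalent indices get the
      same representative.\<close>
    then have "(\<lambda>u. u \<in> T \<and> D u s = 0) = (\<lambda>u. u \<in> T \<and> D u t = 0)"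
      by auto
    then show "rep s = rep t"
      by (simp add: rep_def)
  qed
  have "\<exists>f :: nat \<times> 'a \<Rightarrow> 'a. inj_on f (rep ` T)"
  proof (rule inj_on_if_finite_subsets_inj_on)
    fix F assume F: "finite F" "F \<subseteq> rep ` T"
    have FT: "F \<subseteq> T"
      using F rep by auto
    \<comment> \<open>Distinct representatives have nonzero limit distance, so their threads
      eventually differ. For finitely many of them one \<open>j\<close> serves all pairs, and
      evaluation at \<open>j\<close> is the injection into \<open>'a\<close>.\<close>
    have ev: "\<forall>\<^sub>F j in sequentially. s \<noteq> t \<longrightarrow> th s j \<noteq> th t j" if st: "s \<in> F" "t \<in> F" for s t
    proof (cases "s = t")
      case False
      obtain s' t' where s': "s' \<in> T" "s = rep s'" and t': "t' \<in> T" "t = rep t'"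
        using subsetD[OF F(2) st(1)] subsetD[OF F(2) st(2)] by blast
      have sT: "s \<in> T" "t \<in> T"
        using st FT by auto
      have "rep s = s" "rep t = t"
        using rep rep_eq s' t' by auto
      then have "D s t \<noteq> 0"
        using rep_eq[OF sT] False by simp
      with D[OF sT] have "\<forall>\<^sub>F j in sequentially. mdist (Y j) (th s j) (th t j) \<noteq> 0"
        by (rule tendsto_imp_eventually_ne)
      then show ?thesis
        by eventually_elim (use thY sT in auto)
    qed simp
    have "\<forall>\<^sub>F j in sequentially. \<forall>s\<in>F. \<forall>t\<in>F. s \<noteq> t \<longrightarrow> th s j \<noteq> th t j"
      using F(1) ev by (simp add: eventually_ball_finite)
    then obtain j where "\<forall>s\<in>F. \<forall>t\<in>F. s \<noteq> t \<longrightarrow> th s j \<noteq> th t j"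
      using eventually_happens'[OF sequentially_bot] by blast
    then have "inj_on (\<lambda>s. th s j) F"
      unfolding inj_on_def by blast
    then show "\<exists>f :: nat \<times> 'a \<Rightarrow> 'a. inj_on f F"
      by blast
  qed
  then obtain f :: "nat \<times> 'a \<Rightarrow> 'a" where f: "inj_on f (rep ` T)"
    by blast
  define p where "p = f \<circ> rep"
  have zero: "p s = p t \<longleftrightarrow> D s t = 0" if "s \<in> T" "t \<in> T" for s t
    using that f by (simp add: p_def rep_eq inj_on_eq_iff)
  obtain L where L: "mspace L = p ` T" "\<And>s t. s \<in> T \<Longrightarrow> t \<in> T \<Longrightarrow> mdist L (p s) (p t) = D s t"
    by (rule metric_quotient[of T D p, OF nonneg sym tri zero]) (assumption+, rule that)
  have Tne: "T \<noteq> {}"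
    using ne by (auto simp: T_def)
  have "gh_dist (Y j) L \<le> ennreal (2 * (1/2) ^ j)" for j
  proof (rule gh_dist_le_if_correspondence)
    show "correspondence (Y j) L (2 * (2 * (1/2) ^ j)) {(th t j, p t) | t. t \<in> T}"
      unfolding correspondence_def
    proof (intro conjI allI impI)
      \<comment> \<open>Every \<open>x\<close> of \<open>Y j\<close> is reached, namely by the
        thread indexed \<open>(j, x)\<close>.\<close>
      have "x \<in> (\<lambda>t. th t j) ` T" if "x \<in> mspace (Y j)" for x
        using th(1)[of "(j, x)"] that by (force simp: T_def)
      then show "Domain {(th t j, p t) |t. t \<in> T} = mspace (Y j)"
        using thY by blast
      show "Range {(th t j, p t) |t. t \<in> T} = mspace L"
        by (auto simp: L)
    next
      fix x y x' y' assume "(x, y) \<in> {(th t j, p t) |t. t \<in> T}" "(x', y') \<in> {(th t j, p t) |t. t \<in> T}"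
      then obtain s t where "s \<in> T" "t \<in> T" "x = th s j" "y = p s" "x' = th t j" "y' = p t"
        by blast
      then show "\<bar>mdist (Y j) x x' - mdist L y y'\<bar> \<le> 2 * (2 * (1/2) ^ j)"
        using D_near[of s t j] L(2) by simp
    qed
  qed (use ne in auto)
  then show ?thesis
    using that L Tne by blast
qed

section \<open>Completeness of the whole class and of each cloud\<close>

lemma gh_complete:
  fixes X :: "nat \<Rightarrow> 'a metric"
  assumes ne: "\<And>n. X n \<in> GH_class" and fund: "gh_fundamental X"
  obtains L :: "'a metric" where "L \<in> GH_class" "gh_converges X L"
proof -
  have ne': "mspace (X n) \<noteq> {}" for n
    using ne by (simp add: GH_class_def)
  have "\<forall>k. \<exists>N. \<forall>n\<ge>N. \<forall>m\<ge>N. gh_dist (X n) (X m) < ennreal ((1/2) ^ k)"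
    using fund by (simp add: gh_fundamental_def)
  then obtain N where N: "\<And>k n m. n \<ge> N k \<Longrightarrow> m \<ge> N k \<Longrightarrow> gh_dist (X n) (X m) < ennreal ((1/2) ^ k)"
    by metis
  \<comment> \<open>The sum dominates every \<open>N i\<close> with \<open>i \<le> k\<close>, so
    both \<open>\<nu> k\<close> and \<open>\<nu> (Suc k)\<close> lie beyond \<open>N k\<close>,
    whether or not \<open>N\<close> is monotone.\<close>
  define \<nu> where "\<nu> k = (\<Sum>i\<le>k. N i)" for k
  have \<nu>: "N k \<le> \<nu> k" "N k \<le> \<nu> (Suc k)" for k
    unfolding \<nu>_def by (rule member_le_sum; simp)+
  obtain L :: "'a metric" where L: "mspace L \<noteq> {}" "\<And>k. gh_dist (X (\<nu> k)) L \<le> ennreal (2 * (1/2) ^ k)"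
    using gh_limit_of_fast_sequence[of "\<lambda>k. X (\<nu> k)"] ne' N \<nu> by metis
  have close: "gh_dist (X n) L \<le> ennreal (4 * (1/2) ^ k)" if "n \<ge> N k" for n k
  proof -
    \<comment> \<open>The factor 2 is relaxed to 3 to obtain the strict bound for the triangle
      inequality; 1 + 3 gives the 4 in \<open>close\<close>.\<close>
    have "gh_dist (X (\<nu> k)) L < ennreal (3 * (1/2) ^ k)"
      by (rule le_less_trans[OF L(2)]) (simp add: ennreal_less_iff)
    from gh_dist_triangle_less[OF N[OF that \<nu>(1)] this ne'] show ?thesis
      by simp
  qed
  have "gh_converges X L"
    unfolding gh_converges_def
  proof (rule order_tendstoI)
    fix a :: ennreal assume "0 < a"
    have "(\<lambda>k. ennreal (4 * (1/2) ^ k)) \<longlonglongrightarrow> ennreal (4 * 0)"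
      by (intro tendsto_ennrealI tendsto_mult tendsto_const LIMSEQ_realpow_zero) auto
    then have "\<forall>\<^sub>F k in sequentially. ennreal (4 * (1/2) ^ k) < a"
      using \<open>0 < a\<close> by (intro order_tendstoD(2)) auto
    then obtain k where "ennreal (4 * (1/2) ^ k) < a"
      using eventually_happens'[OF sequentially_bot] by blast
    then show "\<forall>\<^sub>F n in sequentially. gh_dist (X n) L < a"
      using close[of k] unfolding eventually_sequentially by (meson le_less_trans)
  qed simp
  then show ?thesis
    using that L(1) by (simp add: GH_class_def)
qed

theorem theorem2p1:
  shows "(\<forall>X :: nat \<Rightarrow> 'a metric.
            (\<forall>n. X n \<in> GH_class) \<and> gh_fundamental X \<longrightarrow>
            (\<exists>L \<in> (GH_class :: 'a metric set). gh_converges X L)) \<and>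
         (\<forall>C \<in> (clouds :: 'a metric set set). \<forall>X :: nat \<Rightarrow> 'a metric.
            (\<forall>n. X n \<in> C) \<and> gh_fundamental X \<longrightarrow>
            (\<exists>L \<in> C. gh_converges X L))"
proof (intro conjI allI ballI impI)
  fix X :: "nat \<Rightarrow> 'a metric" assume "(\<forall>n. X n \<in> GH_class) \<and> gh_fundamental X"
  then show "\<exists>L \<in> (GH_class :: 'a metric set). gh_converges X L"
    using gh_complete by metis
next
  fix C :: "'a metric set" and X :: "nat \<Rightarrow> 'a metric"
  assume C: "C \<in> clouds" and X: "(\<forall>n. X n \<in> C) \<and> gh_fundamental X"
  \<comment> \<open>A cloud consists of the spaces at finite distance from a representative
    \<open>P\<close>. The limit is close to some \<open>X n\<close>, which is at finite distance
    from \<open>P\<close>, so it stays in the cloud.\<close>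
  obtain P :: "'a metric" where P: "C = {Q. P \<in> GH_class \<and> Q \<in> GH_class \<and> gh_dist P Q < \<infinity>}"
    using C by (auto simp: clouds_def quotient_def Image_def)
  then have XC: "X n \<in> GH_class" "P \<in> GH_class" "gh_dist P (X n) < \<infinity>" for n
    using X by auto
  obtain L :: "'a metric" where L: "L \<in> GH_class" "gh_converges X L"
    using gh_complete XC X by metis
  have "\<forall>\<^sub>F n in sequentially. gh_dist (X n) L < ennreal 1"
    using L(2) unfolding gh_converges_def by (intro order_tendstoD(2)) auto
  then obtain n where n: "gh_dist (X n) L < ennreal 1"
    using eventually_happens'[OF sequentially_bot] by blast
  \<comment> \<open>Density of the order gives a finite bound strictly above the distance.\<close>
  obtain r where "gh_dist P (X n) < ennreal r"
    using dense[OF XC(3)[of n]] by (auto simp: less_top_ennreal)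
  then have "gh_dist P L \<le> ennreal (r + 1)"
    using n XC(2) by (intro gh_dist_triangle_less) (auto simp: GH_class_def)
  then have "gh_dist P L < \<infinity>"
    by (simp add: le_less_trans)
  then show "\<exists>L \<in> C. gh_converges X L"
    using P L XC(2) by blast
qed

end
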